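(* Let $(X,d)$ be a nonempty metric space, let $r\in[0,1]$ and let $U$ be a subset of $F^r_{USCG}(X)$. Then the following properties are equivalent. (i) $U$ is totally bounded in $(F_{USCG}(X), H_{\rm end})$. (ii) $U$ is totally bounded in $(F^r_{USCG}(X), H_{\rm end})$. (iii) $U(\alpha)$ is totally bounded in $(X,d)$ for each $\alpha\in(0,1]$. (iv) $U(\alpha)$ is totally bounded in $(X,d)$ for each $\alpha\in(0,r]$.
   Context: A fuzzy set in $X$ is a function $u:X\to[0,1]$. For $\alpha\in(0,1]$, $[u]_\alpha=\{x\in X: u(x)\ge\alpha\}$, and $[u]_0=\overline{\{x\in X: u(x)>0\}}$ (closure in $X$). $C(X)$ and $K(X)$ denote the sets of all nonempty closed, respectively nonempty compact, subsets of $X$. $F_{USC}(X)$ is the set of fuzzy sets $u$ in $X$ with $[u]_\alpha\in C(X)\cup\{\emptyset\}$ for all $\alpha\in[0,1]$ (the upper semicontinuous fuzzy sets), and $F_{USCG}(X)=\{u\in F_{USC}(X): [u]_\alpha\in K(X)\cup\{\emptyset\}\text{ for all }\alpha\in(0,1]\}$. For $r\in[0,1]$, $F^r_{USCG}(X)=\{u\in F_{USCG}(X): r=\max\{u(x):x\in X\}\}$ (the maximum is required to exist and equal $r$). $X\times[0,1]$ carries the metric $\overline d((x,\alpha),(y,\beta))=d(x,y)+|\alpha-\beta|$. The endograph of $u$ is ${\rm end}\,u=\{(x,t)\in X\times[0,1]: u(x)\ge t\}$; for $u\in F_{USC}(X)$ it is a nonempty closed set. For nonempty closed $A,B\subseteq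 X\times[0,1]$, $H(A,B)=\max\{\sup_{a\in A}\inf_{b\in B}\overline d(a,b),\ \sup_{b\in B}\inf_{a\in A}\overline d(a,b)\}$. The endograph metric on $F_{USC}(X)$ and its subsets is $H_{\rm end}(u,v)=H({\rm end}\,u,{\rm end}\,v)$. For a set $U$ of fuzzy sets, $U(\alpha)=\bigcup_{u\in U}[u]_\alpha$ (an empty union is $\emptyset$). A subset $A$ of a metric space is totally bounded if for each $\varepsilon>0$ there is a finite $S\subseteq A$ such that every point of $A$ is at distance less than $\varepsilon$ from $S$. Convention: $(0,0]=\emptyset$. *)

theory Defs
  imports "HOL-Analysis.Analysis"
begin

text \<open>
  The metric space is a type of class \<open>metric_space\<close>.  A fuzzy set is a function
  \<open>'a \<Rightarrow> real\<close>; that its values lie in \<open>[0,1]\<close> is part of the definition of \<open>F_USC\<close>.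
\<close>

definition level_set :: "('a::metric_space \<Rightarrow> real) \<Rightarrow> real \<Rightarrow> 'a set" where
  "level_set u \<alpha> = (if \<alpha> = 0 then closure {x. u x > 0} else {x. u x \<ge> \<alpha>})"

text \<open>The library predicates \<open>closed\<close> and \<open>compact\<close> hold of the empty set.\<close>

definition F_USC :: "('a::metric_space \<Rightarrow> real) set" where
  "F_USC = {u. (\<forall>x. 0 \<le> u x \<and> u x \<le> 1) \<and> (\<forall>\<alpha>\<in>{0..1}. closed (level_set u \<alpha>))}"

definition F_USCG :: "('a::metric_space \<Rightarrow> real) set" where
  "F_USCG = {u \<in> F_USC. \<forall>\<alpha>\<in>{0<..1}. compact (level_set u \<alpha>)}"

definition F_USCG_max :: "real \<Rightarrow> ('a::metric_space \<Rightarrow> real) set" where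
  "F_USCG_max r = {u \<in> F_USCG. (\<exists>x. u x = r) \<and> (\<forall>x. u x \<le> r)}"

definition endograph :: "('a::metric_space \<Rightarrow> real) \<Rightarrow> ('a \<times> real) set" where
  "endograph u = {(x, t). t \<in> {0..1} \<and> u x \<ge> t}"

text \<open>
  The sum metric on \<open>X \<times> [0,1]\<close>; the library metric \<open>dist\<close> on a product type is the
  Euclidean combination instead.
\<close>

definition dist_sum :: "'a::metric_space \<times> real \<Rightarrow> 'a \<times> real \<Rightarrow> real" where
  "dist_sum p q = dist (fst p) (fst q) + \<bar>snd p - snd q\<bar>"

text \<open>
  The Hausdorff distance may be infinite on general sets, hence the type \<open>ennreal\<close>.  Between
  endographs it is at most \<open>1\<close> (lemma \<open>hausdorff_endograph_le_1\<close>), so \<open>enn2real\<close> in the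
  definition of \<open>H_end\<close> loses nothing.
\<close>

definition hausdorff_sum :: "('a::metric_space \<times> real) set \<Rightarrow> ('a \<times> real) set \<Rightarrow> ennreal" where
  "hausdorff_sum A B =
     max (SUP a\<in>A. INF b\<in>B. ennreal (dist_sum a b)) (SUP b\<in>B. INF a\<in>A. ennreal (dist_sum a b))"

definition H_end :: "('a::metric_space \<Rightarrow> real) \<Rightarrow> ('a \<Rightarrow> real) \<Rightarrow> real" where
  "H_end u v = enn2real (hausdorff_sum (endograph u) (endograph v))"

definition level_union :: "('a::metric_space \<Rightarrow> real) set \<Rightarrow> real \<Rightarrow> 'a set" where
  "level_union U \<alpha> = (\<Union>u\<in>U. level_set u \<alpha>)"


lemma dist_sum_commute: "dist_sum p q = dist_sum q p"
  by (simp add: dist_sum_def dist_commute abs_minus_commute)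

lemma dist_sum_nonneg [simp]: "0 \<le> dist_sum p q"
  by (simp add: dist_sum_def)

lemma dist_sum_triangle: "dist_sum p s \<le> dist_sum p q + dist_sum q s"
  unfolding dist_sum_def using dist_triangle[of "fst p" "fst s" "fst q"] by linarith

lemma hausdorff_sum_commute: "hausdorff_sum A B = hausdorff_sum B A"
  unfolding hausdorff_sum_def
  by (subst max.commute, subst (1 2) dist_sum_commute) simp

lemma endograph_half_le_1:
  assumes "v \<in> F_USC"
  shows "(SUP a\<in>endograph u. INF b\<in>endograph v. ennreal (dist_sum a b)) \<le> 1"
proof (rule SUP_least)
  fix a assume a: "a \<in> endograph u"
  have "(fst a, 0) \<in> endograph v"
    using assms by (auto simp: endograph_def F_USC_def)
  then have "(INF b\<in>endograph v. ennreal (dist_sum a b)) \<le> ennreal (dist_sum a (fst a, 0))"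
    by (rule INF_lower)
  also have "\<dots> \<le> 1"
    using a by (auto simp: endograph_def dist_sum_def)
  finally show "(INF b\<in>endograph v. ennreal (dist_sum a b)) \<le> 1" .
qed

lemma hausdorff_endograph_le_1:
  assumes "u \<in> F_USC" "v \<in> F_USC"
  shows "hausdorff_sum (endograph u) (endograph v) \<le> 1"
  using endograph_half_le_1[OF assms(1), of v] endograph_half_le_1[OF assms(2), of u]
  unfolding hausdorff_sum_def by (simp add: dist_sum_commute)

lemma ennreal_H_end:
  assumes "u \<in> F_USC" "v \<in> F_USC"
  shows "ennreal (H_end u v) = hausdorff_sum (endograph u) (endograph v)"
  unfolding H_end_def using hausdorff_endograph_le_1[OF assms]
  by (intro ennreal_enn2real) (auto simp: le_less_trans)

lemma INF_ennreal_const_add_ne: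
  fixes f :: "'b \<Rightarrow> ennreal"
  assumes "I \<noteq> {}"
  shows "(INF i\<in>I. c + f i) = c + (INF i\<in>I. f i)"
  using continuous_at_Inf_mono[of "\<lambda>x. c + x" "f ` I"] assms
  using continuous_add[of "at_right (Inf (f ` I))", of "\<lambda>x. c" "\<lambda>x. x"]
  by (auto simp: mono_def image_comp)

lemma half_triangle:
  fixes A B C :: "('a::metric_space \<times> real) set"
  shows "(SUP a\<in>A. INF c\<in>C. ennreal (dist_sum a c)) \<le>
     (SUP a\<in>A. INF b\<in>B. ennreal (dist_sum a b)) + (SUP b\<in>B. INF c\<in>C. ennreal (dist_sum b c))"
    (is "_ \<le> ?AB + ?BC")
proof (rule SUP_least)
  fix a assume a: "a \<in> A"
  have "(INF c\<in>C. ennreal (dist_sum a c)) \<le> ennreal (dist_sum a b) + ?BC" if b: "b \<in> B" for b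
  proof -
    have "(INF c\<in>C. ennreal (dist_sum a c)) \<le> (INF c\<in>C. ennreal (dist_sum a b) + ennreal (dist_sum b c))"
      by (intro INF_mono') (simp add: dist_sum_triangle flip: ennreal_plus)
    also have "\<dots> = ennreal (dist_sum a b) + (INF c\<in>C. ennreal (dist_sum b c))"
      by (cases "C = {}") (simp_all add: INF_ennreal_const_add_ne)
    also have "\<dots> \<le> ennreal (dist_sum a b) + ?BC"
      using b by (intro add_left_mono SUP_upper)
    finally show ?thesis .
  qed
  then have "(INF c\<in>C. ennreal (dist_sum a c)) \<le> (INF b\<in>B. ?BC + ennreal (dist_sum a b))"
    by (intro INF_greatest) (simp add: add.commute)
  also have "\<dots> = ?BC + (INF b\<in>B. ennreal (dist_sum a b))"
    by (cases "B = {}") (simp_all add: INF_ennreal_const_add_ne)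
  also have "\<dots> \<le> ?BC + ?AB"
    using a by (intro add_left_mono SUP_upper)
  finally show "(INF c\<in>C. ennreal (dist_sum a c)) \<le> ?AB + ?BC" by (simp add: add.commute)
qed

lemma hausdorff_sum_triangle: "hausdorff_sum A C \<le> hausdorff_sum A B + hausdorff_sum B C"
proof -
  have "(SUP b\<in>C. INF a\<in>A. ennreal (dist_sum a b)) \<le>
      (SUP b\<in>B. INF a\<in>A. ennreal (dist_sum a b)) + (SUP b\<in>C. INF a\<in>B. ennreal (dist_sum a b))"
    using half_triangle[where A = C and B = B and C = A]
    by (simp add: dist_sum_commute add.commute)
  then show ?thesis
    unfolding hausdorff_sum_def
    by (intro max.boundedI order_trans[OF half_triangle[where B = B]])
       (erule order_trans | intro add_mono max.cobounded1 max.cobounded2)+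
qed

lemma hausdorff_sum_self: "hausdorff_sum A A = 0"
proof -
  have "(INF b\<in>A. ennreal (dist_sum a b)) = 0" if "a \<in> A" for a
  proof -
    have "(INF b\<in>A. ennreal (dist_sum a b)) \<le> ennreal (dist_sum a a)"
      using that by (rule INF_lower)
    then show ?thesis by (simp add: dist_sum_def)
  qed
  moreover have "(INF a\<in>A. ennreal (dist_sum a b)) = 0" if "b \<in> A" for b
    using calculation[OF that] by (simp add: dist_sum_commute)
  ultimately have "(SUP a\<in>A. INF b\<in>A. ennreal (dist_sum a b)) \<le> 0"
    "(SUP b\<in>A. INF a\<in>A. ennreal (dist_sum a b)) \<le> 0"
    by - (rule SUP_least, simp)+
  then show ?thesis unfolding hausdorff_sum_def by (simp only: le_zero_eq max.idem)
qed

lemma H_end_zero_imp_le: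
  assumes u: "u \<in> F_USC" and v: "v \<in> F_USC" and 0: "H_end u v = 0"
  shows "u x \<le> v x"
proof (rule dense_le)
  fix \<alpha> assume \<alpha>: "\<alpha> < u x"
  have u01: "0 \<le> u x" "u x \<le> 1" and v01: "\<And>y. 0 \<le> v y" 
    using u v by (auto simp: F_USC_def)
  show "\<alpha> \<le> v x"
  proof (cases "\<alpha> \<le> 0")
    case False
    then have ls: "level_set v \<alpha> = {y. \<alpha> \<le> v y}" by (simp add: level_set_def)
    have cl: "closed {y. \<alpha> \<le> v y}"
      using v False \<alpha> u01 ls by (auto simp: F_USC_def dest!: bspec[of _ _ \<alpha>])
    have mem: "(x, u x) \<in> endograph u" using u01 by (auto simp: endograph_def)
    have "hausdorff_sum (endograph u) (endograph v) = 0"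
      using ennreal_H_end[OF u v] 0 by simp
    then have "(SUP a\<in>endograph u. INF b\<in>endograph v. ennreal (dist_sum a b)) = 0"
      unfolding hausdorff_sum_def by (metis le_zero_eq max.cobounded1)
    then have inf0: "(INF b\<in>endograph v. ennreal (dist_sum (x, u x) b)) = 0"
      using SUP_upper[OF mem, of "\<lambda>a. INF b\<in>endograph v. ennreal (dist_sum a b)"] by simp
    have "\<exists>y\<in>{y. \<alpha> \<le> v y}. dist y x < e" if e: "e > 0" for e
    proof -
      let ?e = "min e (u x - \<alpha>)"
      have "(INF b\<in>endograph v. ennreal (dist_sum (x, u x) b)) < ennreal ?e"
        unfolding inf0 using e \<alpha> by simp
      then obtain b where b: "b \<in> endograph v" "ennreal (dist_sum (x, u x) b) < ennreal ?e"
        by (auto simp: INF_less_iff)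
      then have "dist_sum (x, u x) b < ?e"
        by (simp add: ennreal_less_iff)
      then have "dist x (fst b) + \<bar>u x - snd b\<bar> < e" "dist x (fst b) + \<bar>u x - snd b\<bar> < u x - \<alpha>"
        by (auto simp: dist_sum_def)
      moreover have "snd b \<le> v (fst b)" using b(1) by (auto simp: endograph_def)
      moreover have "0 \<le> dist x (fst b)" by simp
      ultimately have "\<alpha> \<le> v (fst b)" "dist (fst b) x < e"
        by (linarith, simp add: dist_commute)
      then show ?thesis by blast
    qed
    then have "x \<in> closure {y. \<alpha> \<le> v y}" by (simp add: closure_approachable)
    then show ?thesis using cl by simp
  qed (use v01 in \<open>meson order_trans\<close>)
qed

lemma H_end_commute: "H_end u v = H_end v u"
  unfolding H_end_def by (simp add: hausdorff_sum_commute)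

lemma Metric_space_F_USC: "Metric_space F_USC H_end"
proof
  show "0 \<le> H_end u v" for u v :: "'a \<Rightarrow> real" by (simp add: H_end_def)
  show "H_end u v = H_end v u" for u v :: "'a \<Rightarrow> real" by (rule H_end_commute)
  show "H_end u v = 0 \<longleftrightarrow> u = v" if "u \<in> F_USC" "v \<in> F_USC" for u v :: "'a \<Rightarrow> real"
  proof
    assume "H_end u v = 0"
    then show "u = v"
      using H_end_zero_imp_le[OF that] H_end_zero_imp_le[OF that(2,1)]
      by (auto simp: H_end_commute intro!: antisym le_funI)
  qed (simp add: H_end_def hausdorff_sum_self)
  show "H_end u w \<le> H_end u v + H_end v w"
    if "u \<in> F_USC" "v \<in> F_USC" "w \<in> F_USC" for u v w :: "'a \<Rightarrow> real"
  proof -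
    have nn: "0 \<le> H_end p q" for p q :: "'a \<Rightarrow> real" by (simp add: H_end_def)
    have "ennreal (H_end u w) \<le> ennreal (H_end u v + H_end v w)"
      using that hausdorff_sum_triangle by (simp add: nn ennreal_H_end)
    then show ?thesis using nn by (subst (asm) ennreal_le_iff) simp_all
  qed
qed

lemma Metric_space_F_USCG: "Metric_space F_USCG H_end"
  by (rule Metric_space.subspace[OF Metric_space_F_USC]) (auto simp: F_USCG_def)

lemma Metric_space_F_USCG_max: "Metric_space (F_USCG_max r) H_end"
  by (rule Metric_space.subspace[OF Metric_space_F_USCG]) (auto simp: F_USCG_max_def)

end

theory Submission
  imports Defs
begin

text \<open>
  Total boundedness is intrinsic to a set, so the two ambient spaces in the first equivalence
  make no difference; and a level above the common maximum \<open>r\<close> is empty, which disposes of the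
  last equivalence.  The content is the equivalence of total boundedness of \<open>U\<close> for the endograph
  metric with total boundedness of all the sets \<open>U(\<alpha>)\<close>, \<open>\<alpha> > 0\<close>.

  If \<open>U\<close> is totally bounded, take a finite \<open>\<delta>\<close>-net \<open>K\<close> of \<open>U\<close> with \<open>\<delta> \<le> \<alpha>/2\<close>.  A point
  \<open>(x, \<alpha>)\<close> of an endograph is then \<open>\<delta>\<close>-close to a point \<open>(y, s)\<close> in the endograph of a member
  of \<open>K\<close>, and \<open>s\<close> cannot fall below \<open>\<alpha>/2\<close>.  Hence \<open>U(\<alpha>)\<close> lies within \<open>\<delta>\<close> of the finite union of
  the compact sets \<open>[v]\<^bsub>\<alpha>/2\<^esub>\<close>, \<open>v \<in> K\<close> (lemma \<open>level_union_totally_bounded\<close>).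

  Conversely, points of an endograph of height below \<open>1/n\<close> are within \<open>1/n\<close> of height zero, where
  all endographs agree, so only the part over \<open>U(1/n)\<close> matters.  Take a finite net of \<open>U(1/n)\<close>
  and record, for each \<open>u\<close>, which grid points \<open>(s, k/n)\<close> with \<open>s\<close> in the net lie near the
  endograph of \<open>u\<close>.  There are finitely many records, and members of \<open>U\<close> with the same record are
  close (lemma \<open>totally_bounded_if_level_unions\<close>), so one member of \<open>U\<close> per record is a net.
\<close>

text \<open>
  Sorting a set into finitely many classes of small diameter gives a net made of one
  representative per class.  The centres of the balls then lie in the set, as total boundedness
  requires, whatever objects label the classes: points outside the set, or finite records.
\<close>

lemma (in Metric_space) mtotally_bounded_if_finite_classification:
  assumes "S \<subseteq> M"
    and classify: "\<And>e. 0 < e \<Longrightarrow>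
      \<exists>f :: 'a \<Rightarrow> 'c. finite (f ` S) \<and> (\<forall>x\<in>S. \<forall>y\<in>S. f x = f y \<longrightarrow> d x y < e)"
  shows "mtotally_bounded S"
  unfolding mtotally_bounded_def
proof (intro allI impI)
  fix e :: real assume "0 < e"
  then obtain f :: "'a \<Rightarrow> 'c" where fin: "finite (f ` S)"
    and f: "\<And>x y. x \<in> S \<Longrightarrow> y \<in> S \<Longrightarrow> f x = f y \<Longrightarrow> d x y < e"
    using classify by blast
  obtain K where K: "K \<subseteq> S" "finite K" "f ` S = f ` K"
    using finite_subset_image[OF fin subset_refl] by blast
  have "S \<subseteq> (\<Union>x\<in>K. mball x e)"
  proof
    fix y assume y: "y \<in> S"
    then obtain x where "x \<in> K" "f x = f y" using K(3) by (metis imageE imageI)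
    then show "y \<in> (\<Union>x\<in>K. mball x e)"
      using y K(1) \<open>S \<subseteq> M\<close> f[of x y] by auto
  qed
  then show "\<exists>K. finite K \<and> K \<subseteq> S \<and> S \<subseteq> (\<Union>x\<in>K. mball x e)"
    using K by blast
qed

lemma mtotally_bounded_if_finite_nets:
  fixes S :: "'a::metric_space set"
  assumes "\<And>e. 0 < e \<Longrightarrow> \<exists>F. finite F \<and> (\<forall>x\<in>S. \<exists>z\<in>F. dist z x < e)"
  shows "Met_TC.mtotally_bounded S"
proof (rule Met_TC.mtotally_bounded_if_finite_classification)
  fix e :: real assume "0 < e"
  then obtain F where F: "finite F" "\<forall>x\<in>S. \<exists>z\<in>F. dist z x < e/2"
    using assms[of "e/2"] by auto
  then obtain f where f: "\<And>x. x \<in> S \<Longrightarrow> f x \<in> F \<and> dist (f x) x < e/2" by metis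
  have "finite (f ` S)" using f F(1) by (meson finite_subset image_subsetI)
  moreover have "dist x y < e" if "x \<in> S" "y \<in> S" "f x = f y" for x y
    using f[OF that(1)] f[OF that(2)] that(3) dist_triangle3[of x y "f x"] by simp
  ultimately show "\<exists>f :: 'a \<Rightarrow> 'a. finite (f ` S) \<and> (\<forall>x\<in>S. \<forall>y\<in>S. f x = f y \<longrightarrow> dist x y < e)"
    by blast
qed simp

lemma H_end_less_imp_close_point:
  assumes u: "u \<in> F_USC" and v: "v \<in> F_USC" and less: "H_end u v < e"
    and p: "p \<in> endograph u"
  shows "\<exists>q\<in>endograph v. dist_sum p q < e"
proof -
  have "0 \<le> H_end u v" by (simp add: H_end_def)
  have "(INF q\<in>endograph v. ennreal (dist_sum p q)) \<le>
      (SUP a\<in>endograph u. INF b\<in>endograph v. ennreal (dist_sum a b))"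
    using p by (rule SUP_upper)
  also have "\<dots> \<le> ennreal (H_end u v)"
    unfolding ennreal_H_end[OF u v] hausdorff_sum_def by (rule max.cobounded1)
  also have "\<dots> < ennreal e" using less \<open>0 \<le> H_end u v\<close> by (simp add: ennreal_less_iff)
  finally show ?thesis by (auto simp: INF_less_iff ennreal_less_iff)
qed

lemma H_end_le_if_close_points:
  assumes "0 \<le> c"
    and uv: "\<And>p. p \<in> endograph u \<Longrightarrow> \<exists>q\<in>endograph v. dist_sum p q \<le> c"
    and vu: "\<And>q. q \<in> endograph v \<Longrightarrow> \<exists>p\<in>endograph u. dist_sum q p \<le> c"
  shows "H_end u v \<le> c"
proof -
  have half: "(SUP a\<in>A. INF b\<in>B. ennreal (dist_sum a b)) \<le> ennreal c"
    if "\<And>p. p \<in> A \<Longrightarrow> \<exists>q\<in>B. dist_sum p q \<le> c" for A B :: "('a \<times> real) set"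
    using that by (intro SUP_least) (meson INF_lower2 ennreal_leI)
  have "hausdorff_sum (endograph u) (endograph v) \<le> ennreal c"
    unfolding hausdorff_sum_def
    using half[OF uv] half[OF vu] by (simp add: dist_sum_commute)
  then show ?thesis
    unfolding H_end_def using \<open>0 \<le> c\<close> by (simp add: enn2real_leI)
qed

text \<open>
  Moving a point of height \<open>\<alpha>\<close> by at most \<open>\<alpha>/2\<close> keeps it at height \<open>\<alpha>/2\<close> or more, so the
  \<open>\<alpha>\<close>-levels of all members of \<open>U\<close> are near the \<open>\<alpha>/2\<close>-levels of finitely many of them, and
  those are compact.
\<close>

lemma level_union_totally_bounded:
  fixes U :: "('a::metric_space \<Rightarrow> real) set"
  assumes U: "U \<subseteq> F_USCG" and tb: "Metric_space.mtotally_bounded F_USCG H_end U"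
    and \<alpha>: "\<alpha> \<in> {0<..1}"
  shows "Met_TC.mtotally_bounded (level_union U \<alpha>)"
proof (rule mtotally_bounded_if_finite_nets)
  interpret G: Metric_space "F_USCG :: ('a \<Rightarrow> real) set" H_end by (rule Metric_space_F_USCG)
  fix e :: real assume e: "0 < e"
  define \<delta> where "\<delta> = min (e/2) (\<alpha>/2)"
  have \<delta>: "0 < \<delta>" "\<delta> \<le> e/2" "\<delta> \<le> \<alpha>/2" using e \<alpha> by (auto simp: \<delta>_def)
  obtain K where K: "finite K" "K \<subseteq> U" "U \<subseteq> (\<Union>v\<in>K. G.mball v \<delta>)"
    using tb[unfolded G.mtotally_bounded_def, rule_format, OF \<delta>(1)] by blast
  have "compact (\<Union>v\<in>K. level_set v (\<alpha>/2))"
    using K(1,2) U \<alpha> by (intro compact_UN) (auto simp: F_USCG_def)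
  then obtain F where F: "finite F" "(\<Union>v\<in>K. level_set v (\<alpha>/2)) \<subseteq> (\<Union>z\<in>F. ball z (e/2))"
    using e unfolding compact_eq_totally_bounded by (meson half_gt_zero)
  have "\<exists>z\<in>F. dist z x < e" if x: "x \<in> level_union U \<alpha>" for x
  proof -
    from x obtain u where u: "u \<in> U" "\<alpha> \<le> u x"
      using \<alpha> by (auto simp: level_union_def level_set_def)
    then obtain v where v: "v \<in> K" "H_end u v < \<delta>"
      using K(3) by (force simp: H_end_commute)
    have "(x, \<alpha>) \<in> endograph u" using u \<alpha> by (simp add: endograph_def)
    moreover have "u \<in> F_USC" "v \<in> F_USC" using u v K(2) U by (auto simp: F_USCG_def)
    ultimately obtain q where "q \<in> endograph v" "dist_sum (x, \<alpha>) q < \<delta>"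
      using H_end_less_imp_close_point v(2) by blast
    then obtain y s where ys: "s \<le> v y" "dist x y + \<bar>\<alpha> - s\<bar> < \<delta>"
      by (auto simp: endograph_def dist_sum_def)
    have "\<alpha>/2 \<le> v y" using ys \<delta>(3) zero_le_dist[of x y] by linarith
    then have "y \<in> level_set v (\<alpha>/2)" using \<alpha> by (simp add: level_set_def)
    then obtain z where "z \<in> F" "dist z y < e/2" using F(2) v(1) by auto
    moreover have "dist x y < e/2" using ys \<delta>(2) by linarith
    ultimately show ?thesis using dist_triangle2[of z x y] by (intro bexI[of _ z]) linarith+
  qed
  then show "\<exists>F. finite F \<and> (\<forall>x\<in>level_union U \<alpha>. \<exists>z\<in>F. dist z x < e)" using F(1) by blast
qed

text \<open>
  The record of \<open>u\<close> is the trace of its endograph on the grid of pairs \<open>(s, k/n)\<close>, up to an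
  error \<open>\<delta>\<close> in the first coordinate.
\<close>

definition grid_trace :: "'a::metric_space set \<Rightarrow> nat \<Rightarrow> real \<Rightarrow> ('a \<Rightarrow> real) \<Rightarrow> ('a \<times> nat) set" where
  "grid_trace S n \<delta> u = {(s, k) \<in> S \<times> {..n}. \<exists>y. dist s y < \<delta> \<and> real k / real n \<le> u y}"

text \<open>
  A point \<open>(x, t)\<close> of an endograph is pushed down to the grid height \<open>k/n\<close> just below \<open>t\<close>, at
  cost \<open>1/n\<close>, then moved through a net point \<open>s\<close> near \<open>x\<close> to the point near \<open>s\<close> that the equal
  trace provides, at cost \<open>2\<delta>\<close>.  For \<open>t < 1/n\<close> the net need not reach \<open>x\<close>, but then
  \<open>(x, 0)\<close> is a near point of the other endograph.
\<close>

lemma endograph_close_if_grid_trace_subset: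
  assumes u: "u \<in> F_USC" and v: "v \<in> F_USC" and n: "0 < n" and \<delta>: "0 \<le> \<delta>"
    and net: "\<And>x. 1 / real n \<le> u x \<Longrightarrow> \<exists>s\<in>S. dist s x < \<delta>"
    and trace: "grid_trace S n \<delta> u \<subseteq> grid_trace S n \<delta> v"
    and p: "p \<in> endograph u"
  shows "\<exists>q\<in>endograph v. dist_sum p q \<le> 2 * \<delta> + 1 / real n"
proof -
  obtain x t where xt: "p = (x, t)" "0 \<le> t" "t \<le> 1" "t \<le> u x"
    using p by (auto simp: endograph_def)
  define k where "k = nat \<lfloor>real n * t\<rfloor>"
  have "real k \<le> real n * t" "real n * t < real k + 1"
    using xt(2) unfolding k_def by (auto simp: of_nat_floor)
  then have k: "real k / n \<le> t" "t < real k / n + 1 / n"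
    using n by (simp_all add: field_simps)
  have "real k \<le> real n"
    using \<open>real k \<le> real n * t\<close> xt(3) mult_left_le[of t "real n"] by simp
  show ?thesis
  proof (cases "k = 0")
    case True
    have "(x, 0) \<in> endograph v" using v by (simp add: endograph_def F_USC_def)
    moreover have "dist_sum p (x, 0) \<le> 2 * \<delta> + 1 / real n"
      using k True xt \<delta> by (simp add: dist_sum_def)
    ultimately show ?thesis by blast
  next
    case False
    then have "1 / real n \<le> real k / n" by (simp add: divide_right_mono)
    then obtain s where s: "s \<in> S" "dist s x < \<delta>" using net[of x] k xt by force
    then have "(s, k) \<in> grid_trace S n \<delta> u"
      using k xt \<open>real k \<le> real n\<close> by (auto simp: grid_trace_def intro!: exI[of _ x])
    then obtain y where y: "dist s y < \<delta>" "real k / n \<le> v y"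
      using trace by (auto simp: grid_trace_def)
    have "(y, real k / n) \<in> endograph v" using y k xt by (simp add: endograph_def)
    moreover have "dist_sum p (y, real k / n) \<le> 2 * \<delta> + 1 / real n"
      using k xt s y dist_triangle3[of x y s] by (simp add: dist_sum_def)
    ultimately show ?thesis by blast
  qed
qed

text \<open>
  With net radius \<open>e/4\<close> and grid step below \<open>e/4\<close>, equal traces force a distance of at most
  \<open>2 \<cdot> e/4 + 1/n < e\<close>, and there are only finitely many subsets of the finite grid.
\<close>

lemma totally_bounded_if_level_unions:
  fixes U :: "('a::metric_space \<Rightarrow> real) set"
  assumes U: "U \<subseteq> F_USC"
    and tb: "\<And>\<alpha>. \<alpha> \<in> {0<..1} \<Longrightarrow> Met_TC.mtotally_bounded (level_union U \<alpha>)"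
  shows "Metric_space.mtotally_bounded F_USC H_end U"
proof -
  interpret F: Metric_space "F_USC :: ('a \<Rightarrow> real) set" H_end by (rule Metric_space_F_USC)
  show ?thesis
  proof (rule F.mtotally_bounded_if_finite_classification[OF U])
    fix e :: real assume e: "0 < e"
    obtain n where n: "0 < n" "1 / real n < e/4"
      using e by (metis nat_approx_posE zero_less_Suc divide_pos_pos zero_less_numeral)
    have "Met_TC.mtotally_bounded (level_union U (1 / real n))"
      using n by (intro tb) (simp add: field_simps)
    then obtain S where S: "finite S" "level_union U (1 / real n) \<subseteq> (\<Union>s\<in>S. ball s (e/4))"
      using e unfolding Met_TC.mtotally_bounded_def by (metis mball_eq_ball divide_pos_pos zero_less_numeral)
    let ?trace = "grid_trace S n (e/4)"
    have net: "\<exists>s\<in>S. dist s x < e/4" if "u \<in> U" "1 / real n \<le> u x" for u x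
    proof -
      have "x \<in> level_union U (1 / real n)" using that n by (auto simp: level_union_def level_set_def)
      then obtain s where "s \<in> S" "x \<in> ball s (e/4)" using S(2) by blast
      then show ?thesis unfolding mem_ball by blast
    qed
    have "?trace ` U \<subseteq> Pow (S \<times> {..n})" by (auto simp: grid_trace_def)
    then have "finite (?trace ` U)" using S(1) by (simp add: finite_subset)
    moreover have "H_end u v < e" if "u \<in> U" "v \<in> U" "?trace u = ?trace v" for u v
    proof -
      have "u \<in> F_USC" "v \<in> F_USC" using that U by auto
      then have "H_end u v \<le> 2 * (e/4) + 1 / real n"
        using that e n(1) net
        by (intro H_end_le_if_close_points endograph_close_if_grid_trace_subset[where S = S]) auto
      also have "\<dots> < e" using n(2) e by simp
      finally show ?thesis .
    qed
    ultimately show "\<exists>f :: _ \<Rightarrow> ('a \<times> nat) set.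
        finite (f ` U) \<and> (\<forall>u\<in>U. \<forall>v\<in>U. f u = f v \<longrightarrow> H_end u v < e)"
      by blast
  qed
qed

theorem corollary6p11:
  fixes U :: "('a::metric_space \<Rightarrow> real) set" and r :: real
  assumes "r \<in> {0..1}"
    and "U \<subseteq> F_USCG_max r"
  shows "(Metric_space.mtotally_bounded F_USCG H_end U
            \<longleftrightarrow> Metric_space.mtotally_bounded (F_USCG_max r) H_end U)
       \<and> (Metric_space.mtotally_bounded (F_USCG_max r) H_end U
            \<longleftrightarrow> (\<forall>\<alpha>\<in>{0<..1}. Metric_space.mtotally_bounded UNIV dist (level_union U \<alpha>)))
       \<and> ((\<forall>\<alpha>\<in>{0<..1}. Metric_space.mtotally_bounded UNIV dist (level_union U \<alpha>))
            \<longleftrightarrow> (\<forall>\<alpha>\<in>{0<..r}. Metric_space.mtotally_bounded UNIV dist (level_union U \<alpha>)))"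
proof -
  have sub: "F_USCG_max r \<subseteq> F_USCG" "F_USCG \<subseteq> (F_USC :: ('a \<Rightarrow> real) set)"
    by (auto simp: F_USCG_max_def F_USCG_def)
  then have U: "U \<subseteq> F_USCG" "U \<subseteq> F_USC" using assms(2) by auto
  note intrinsic = Metric_space.mtotally_bounded_absolute[OF Metric_space_F_USCG, of U]
    Metric_space.mtotally_bounded_absolute[OF Metric_space_F_USCG_max, of r U]
    Metric_space.mtotally_bounded_absolute[OF Metric_space_F_USC, of U]
  have ambient: "Metric_space.mtotally_bounded F_USCG H_end U
      \<longleftrightarrow> Metric_space.mtotally_bounded (F_USCG_max r) H_end U"
    using intrinsic U assms(2) by simp
  have levels: "Metric_space.mtotally_bounded F_USCG H_end U
      \<longleftrightarrow> (\<forall>\<alpha>\<in>{0<..1}. Met_TC.mtotally_bounded (level_union U \<alpha>))"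
    using level_union_totally_bounded[OF U(1)] totally_bounded_if_level_unions[OF U(2)]
      intrinsic U by blast
  have empty: "level_union U \<alpha> = {}" if "r < \<alpha>" for \<alpha>
  proof -
    have "\<not> \<alpha> \<le> u x" if "u \<in> U" for u x
    proof -
      have "u x \<le> r" using subsetD[OF assms(2) that] by (simp add: F_USCG_max_def)
      then show ?thesis using \<open>r < \<alpha>\<close> by simp
    qed
    \<comment> \<open>The level set at \<open>0\<close> is a closure and obeys a different formula.\<close>
    moreover have "\<alpha> \<noteq> 0" using \<open>r < \<alpha>\<close> assms(1) by simp
    ultimately show ?thesis by (simp add: level_union_def level_set_def)
  qed
  have "(\<forall>\<alpha>\<in>{0<..1}. Met_TC.mtotally_bounded (level_union U \<alpha>))
      \<longleftrightarrow> (\<forall>\<alpha>\<in>{0<..r}. Met_TC.mtotally_bounded (level_union U \<alpha>))" (is "?all \<longleftrightarrow> ?low")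
  proof
    assume ?all
    then show ?low using assms(1) by simp
  next
    assume low: ?low
    show ?all
    proof
      fix \<alpha> :: real assume "\<alpha> \<in> {0<..1}"
      then show "Met_TC.mtotally_bounded (level_union U \<alpha>)"
        using low empty[of \<alpha>] by (cases "\<alpha> \<le> r") simp_all
    qed
  qed
  with ambient levels show ?thesis by blast
qed

end
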